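(* Let $G$ be a finite simple graph that is $(P_3\cup P_2,\text{ hammer})$-free, i.e. $G$ has no induced subgraph isomorphic to $P_3\cup P_2$ and no induced subgraph isomorphic to the hammer. Then $\chi(G)\le \omega(G)^2$.
   Context: All graphs are finite and simple. $\chi(G)$ is the chromatic number of $G$ and $\omega(G)$ is the clique number (maximum size of a clique). $P_k$ denotes the path on $k$ vertices. For vertex-disjoint graphs $A,B$, the union $A\cup B$ is their disjoint union; thus $P_3\cup P_2$ has 5 vertices $a,b,c,d,e$ and exactly the edges $ab,bc,de$. The hammer is the graph on 5 vertices $v_1,v_2,v_3,v_4,v_5$ with exactly the edges $v_1v_2,v_1v_3,v_2v_3,v_3v_4,v_4v_5$; that is, a triangle with a pendant path of length 2 attached at one of its vertices. *)

theory Defs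
  imports "Graph_Theory.Graph_Theory"
begin

text \<open>
  A finite simple graph is a \<^locale>\<open>pair_graph\<close>: a finite vertex set with a symmetric, irreflexive
  set of arcs, so that every undirected edge \<open>uv\<close> is present as the two arcs \<open>(u,v)\<close> and \<open>(v,u)\<close>.
  The null graph is allowed.
\<close>

definition graph_of_edges :: "'a set \<Rightarrow> ('a \<times> 'a) set \<Rightarrow> 'a pair_pre_digraph" where
  "graph_of_edges V E = \<lparr> pverts = V, parcs = E \<union> E\<inverse> \<rparr>"

definition path_graph :: "nat \<Rightarrow> nat pair_pre_digraph" where
  "path_graph k = graph_of_edges {..<k} {(i, Suc i) | i. Suc i < k}"

definition disjoint_graph_union ::
    "'a pair_pre_digraph \<Rightarrow> 'b pair_pre_digraph \<Rightarrow> ('a + 'b) pair_pre_digraph" where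
  "disjoint_graph_union A B =
    \<lparr> pverts = pverts A <+> pverts B,
      parcs = map_prod Inl Inl ` parcs A \<union> map_prod Inr Inr ` parcs B \<rparr>"

definition P3_P2 :: "(nat + nat) pair_pre_digraph" where
  "P3_P2 = disjoint_graph_union (path_graph 3) (path_graph 2)"

definition hammer :: "nat pair_pre_digraph" where
  "hammer = graph_of_edges {1, 2, 3, 4, 5} {(1, 2), (1, 3), (2, 3), (3, 4), (4, 5)}"

definition contains_induced :: "'a pair_pre_digraph \<Rightarrow> 'b pair_pre_digraph \<Rightarrow> bool" where
  "contains_induced G H \<longleftrightarrow>
    (\<exists>H'. induced_subgraph H' (with_proj G) \<and> digraph_iso H' (with_proj H))"

definition clique :: "'a pair_pre_digraph \<Rightarrow> 'a set \<Rightarrow> bool" where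
  "clique G S \<longleftrightarrow> S \<subseteq> pverts G \<and> (\<forall>u\<in>S. \<forall>v\<in>S. u \<noteq> v \<longrightarrow> (u, v) \<in> parcs G)"

definition clique_number :: "'a pair_pre_digraph \<Rightarrow> nat" where
  "clique_number G = Max {card S | S. clique G S}"

definition proper_colouring :: "'a pair_pre_digraph \<Rightarrow> nat \<Rightarrow> ('a \<Rightarrow> nat) \<Rightarrow> bool" where
  "proper_colouring G k c \<longleftrightarrow>
    (\<forall>v\<in>pverts G. c v < k) \<and> (\<forall>(u, v)\<in>parcs G. c u \<noteq> c v)"

definition chromatic_number :: "'a pair_pre_digraph \<Rightarrow> nat" where
  "chromatic_number G = (LEAST k. \<exists>c. proper_colouring G k c)"

text \<open>
  In a \<^locale>\<open>pair_graph\<close>, the \<^const>\<open>Max\<close> and the \<^const>\<open>Least\<close> above range over a finite nonempty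
  and a nonempty set, respectively.
\<close>

lemma (in pair_graph) clique_cards:
  "finite {card S | S. clique G S}" "{card S | S. clique G S} \<noteq> {}"
proof -
  have "{card S | S. clique G S} \<subseteq> card ` Pow (pverts G)"
    by (auto simp: clique_def)
  then show "finite {card S | S. clique G S}"
    using pair_finite_verts by (meson finite_Pow_iff finite_imageI finite_subset)
  have "clique G {}"
    by (simp add: clique_def)
  then show "{card S | S. clique G S} \<noteq> {}"
    by blast
qed

lemma (in pair_graph) proper_colouring_exists: "\<exists>k c. proper_colouring G k c"
proof -
  obtain c :: "'a \<Rightarrow> nat" where c: "inj_on c (pverts G)"
    using finite_imp_inj_to_nat_seg[OF pair_finite_verts] by metis
  have "c v < Suc (Max (c ` pverts G))" if "v \<in> pverts G" for v
    using that pair_finite_verts by (simp add: less_Suc_eq_le)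
  moreover have "c u \<noteq> c v" if "(u, v) \<in> parcs G" for u v
    using inj_onD[OF c _ in_arcsD1[OF that] in_arcsD2[OF that]] no_loops'[OF that] by auto
  ultimately show ?thesis
    unfolding proper_colouring_def by blast
qed

lemma converse_insert: "(insert (a, b) r)\<inverse> = insert (b, a) (r\<inverse>)"
  by auto

lemma P3_P2_explicit:
  "P3_P2 = graph_of_edges {Inl 0, Inl 1, Inl 2, Inr 0, Inr 1}
    {(Inl 0, Inl 1), (Inl 1, Inl 2), (Inr 0, Inr 1)}"
proof -
  have "Suc i < 3 \<longleftrightarrow> i = 0 \<or> i = 1" for i
    by linarith
  then have "{(i, Suc i) | i. Suc i < 3} = (\<lambda>i. (i, Suc i)) ` {0, 1}"
    by (simp only:) blast
  moreover have "Suc i < 2 \<longleftrightarrow> i = 0" for i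
    by linarith
  then have "{(i, Suc i) | i. Suc i < 2} = (\<lambda>i. (i, Suc i)) ` {0}"
    by (simp only:) blast
  ultimately show ?thesis
    by (simp add: P3_P2_def disjoint_graph_union_def path_graph_def graph_of_edges_def Plus_def
        numeral_eq_Suc lessThan_Suc converse_insert insert_commute)
qed

lemma pair_graph_graph_of_edges:
  assumes "finite V" "E \<subseteq> V \<times> V" "\<And>u. (u, u) \<notin> E"
  shows "pair_graph (graph_of_edges V E)"
proof
  show "finite (parcs (graph_of_edges V E))"
    using assms finite_subset[OF assms(2)] by (simp add: graph_of_edges_def)
  show "symmetric (with_proj (graph_of_edges V E))"
    by (auto simp: graph_of_edges_def symmetric_def sym_def)
qed (use assms in \<open>auto simp: graph_of_edges_def\<close>)

lemma pair_graph_P3_P2: "pair_graph P3_P2"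
  unfolding P3_P2_explicit by (rule pair_graph_graph_of_edges) simp_all

lemma pair_graph_hammer: "pair_graph hammer"
  unfolding hammer_def by (rule pair_graph_graph_of_edges) simp_all

end

theory Submission
  imports Defs
begin

text \<open>
  Fix a maximum clique \<open>K\<close> and let \<open>M x\<close> be the set of vertices of \<open>K\<close> that are not adjacent to \<open>x\<close>
  (so \<open>x \<in> M x\<close> if \<open>x \<in> K\<close>).
  A clique \<open>Q\<close> on which \<open>M\<close> is constant satisfies \<open>|Q| \<le> |M|\<close>, because \<open>Q \<union> (K - M)\<close> is a clique;
  in particular, adjacent vertices with the same \<open>M\<close> have \<open>|M| \<ge> 2\<close>. Hence the vertices with
  a given \<open>M\<close> induce a disjoint union of cliques \<open>Q\<close>: an induced \<open>P\<^sub>3\<close> among them would form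
  an induced \<open>P\<^sub>3 \<union> P\<^sub>2\<close> with two vertices of \<open>M\<close>.
  If \<open>x\<close> and \<open>y\<close> are adjacent and \<open>M x \<inter> M y\<close> has two elements \<open>i, j\<close>, then \<open>M x = M y\<close>: otherwise,
  say, \<open>k \<in> M y - M x\<close>, and the triangle \<open>i j k\<close> with the path \<open>k x y\<close> is a hammer.
  Now give the vertices of each \<open>Q\<close> distinct colours \<open>(i, j) \<in> M \<times> M\<close>, with \<open>i \<noteq> j\<close> unless
  \<open>M = {i}\<close>. Adjacent vertices with the same colour would have the same \<open>M\<close>, so they would lie in
  the same \<open>Q\<close>, a contradiction. This uses \<open>|K|\<^sup>2\<close> colours.
\<close>

section \<open>Induced subgraphs from explicit embeddings\<close>

lemma contains_inducedI:
  assumes G: "pair_wf_digraph G" and H: "pair_wf_digraph H"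
    and inj: "inj_on f (pverts H)" and verts: "f ` pverts H \<subseteq> pverts G"
    and arcs: "\<And>u v. u \<in> pverts H \<Longrightarrow> v \<in> pverts H \<Longrightarrow> (f u, f v) \<in> parcs G \<longleftrightarrow> (u, v) \<in> parcs H"
  shows "contains_induced G H"
proof -
  interpret G: pair_wf_digraph G by (rule G)
  interpret H: pair_wf_digraph H by (rule H)
  define \<phi> where "\<phi> = \<lparr>iso_verts = f, iso_arcs = map_prod f f, iso_head = snd, iso_tail = fst\<rparr>"
  have "inj_on (map_prod f f) (parcs H)"
    using map_prod_inj_on[OF inj inj] by (rule inj_on_subset) (auto dest: H.in_arcsD1 H.in_arcsD2)
  then have "H.digraph_isomorphism \<phi>"
    unfolding H.digraph_isomorphism_def using inj by (auto simp: \<phi>_def H.wf_digraph)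
  then have iso: "digraph_iso (with_proj H) (app_iso \<phi> (with_proj H))"
    unfolding digraph_iso_def by blast
  have "app_iso \<phi> (with_proj H) = with_proj G \<restriction> f ` pverts H"
  proof -
    have "map_prod f f ` parcs H
        = {e \<in> parcs G. fst e \<in> f ` pverts H \<and> snd e \<in> f ` pverts H}" (is "?L = ?R")
    proof
      show "?L \<subseteq> ?R"
        using arcs by (auto dest: H.in_arcsD1 H.in_arcsD2)
      show "?R \<subseteq> ?L"
        using arcs by (force simp: image_iff)
    qed
    then show ?thesis
      by (simp add: app_iso_def induce_subgraph_def \<phi>_def)
  qed
  moreover have "induced_subgraph (with_proj G \<restriction> f ` pverts H) (with_proj G)"
    using G.induced_induce verts by simp
  ultimately show ?thesis
    unfolding contains_induced_def using digraph_iso_swap[OF H.wf_digraph iso] by metis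
qed

lemma chromatic_number_le:
  assumes "proper_colouring G k c"
  shows "chromatic_number G \<le> k"
  unfolding chromatic_number_def using assms by (blast intro: Least_le)

definition missed :: "'a pair_pre_digraph \<Rightarrow> 'a set \<Rightarrow> 'a \<Rightarrow> 'a set" where
  "missed G K x = {v \<in> K. (x, v) \<notin> parcs G}"

context pair_graph
begin

lemma arc_sym: "(u, v) \<in> parcs G \<longleftrightarrow> (v, u) \<in> parcs G"
  using sym_arcs unfolding symmetric_def by (auto dest: symD)

lemmas arc_sym_imp = arc_sym[THEN iffD1]

lemma not_arc_sym: "(u, v) \<notin> parcs G \<Longrightarrow> (v, u) \<notin> parcs G"
  using arc_sym by blast

text \<open>The ends \<open>a\<close> and \<open>c\<close> of the path have the same neighbours, so
  \<open>a \<noteq> c\<close> is a separate assumption. Any other two of the five vertices are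
  adjacent or are told apart by a third one.\<close>

lemma contains_P3_P2I:
  assumes "(a, b) \<in> parcs G" "(b, c) \<in> parcs G" "(d, e) \<in> parcs G"
    and "(a, c) \<notin> parcs G" "a \<noteq> c"
    and "\<And>u v. u \<in> {a, b, c} \<Longrightarrow> v \<in> {d, e} \<Longrightarrow> (u, v) \<notin> parcs G"
  shows "contains_induced G P3_P2"
proof -
  let ?f = "case_sum (\<lambda>n. [a, b, c] ! n) (\<lambda>n. [d, e] ! n)"
  have non: "(a, d) \<notin> parcs G" "(a, e) \<notin> parcs G" "(b, d) \<notin> parcs G" "(b, e) \<notin> parcs G"
    "(c, d) \<notin> parcs G" "(c, e) \<notin> parcs G"
    using assms(6) by auto
  have ne: "a \<noteq> b" "b \<noteq> c" "d \<noteq> e" "a \<noteq> d" "a \<noteq> e" "b \<noteq> d" "b \<noteq> e" "c \<noteq> d" "c \<noteq> e"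
    using assms(1-3) non no_loops' arc_sym by metis+
  have in_verts: "a \<in> pverts G" "b \<in> pverts G" "c \<in> pverts G" "d \<in> pverts G" "e \<in> pverts G"
    using assms(1-3) in_arcsD1 in_arcsD2 by blast+
  have loops: "(u, u) \<notin> parcs G" for u
    using no_loops' by blast
  show ?thesis
  proof (rule contains_inducedI[where f = ?f])
    show "pair_wf_digraph G" ..
    show "pair_wf_digraph P3_P2"
      using pair_graph_P3_P2 by (simp add: pair_graph_def pair_digraph_def pair_fin_digraph_def)
    show "inj_on ?f (pverts P3_P2)"
      using ne \<open>a \<noteq> c\<close> by (auto simp: P3_P2_explicit graph_of_edges_def)
    show "?f ` pverts P3_P2 \<subseteq> pverts G"
      using in_verts by (auto simp: P3_P2_explicit graph_of_edges_def)
    \<comment> \<open>Over the explicit vertex set, the bounded quantifiers unfold into finitely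
      many pairs.\<close>
    have "\<forall>u\<in>pverts P3_P2. \<forall>v\<in>pverts P3_P2. (?f u, ?f v) \<in> parcs G \<longleftrightarrow> (u, v) \<in> parcs P3_P2"
      by (simp add: P3_P2_explicit graph_of_edges_def converse_insert loops
          assms(1-4) non assms(1-3)[THEN arc_sym_imp] assms(4)[THEN not_arc_sym]
          non[THEN not_arc_sym])
    then show "(?f u, ?f v) \<in> parcs G \<longleftrightarrow> (u, v) \<in> parcs P3_P2"
      if "u \<in> pverts P3_P2" "v \<in> pverts P3_P2" for u v
      using that by blast
  qed
qed

lemma contains_hammerI:
  assumes "(a, b) \<in> parcs G" "(a, c) \<in> parcs G" "(b, c) \<in> parcs G" "(c, d) \<in> parcs G"
      "(d, e) \<in> parcs G"
    and "(a, d) \<notin> parcs G" "(b, d) \<notin> parcs G"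
    and "(a, e) \<notin> parcs G" "(b, e) \<notin> parcs G" "(c, e) \<notin> parcs G"
  shows "contains_induced G hammer"
proof -
  \<comment> \<open>The vertices of \<open>hammer\<close> are numbered from 1, list positions from
    0.\<close>
  let ?f = "\<lambda>n. [a, b, c, d, e] ! (n - 1)"
  have ne: "a \<noteq> b" "a \<noteq> c" "b \<noteq> c" "c \<noteq> d" "d \<noteq> e" "a \<noteq> d" "a \<noteq> e" "b \<noteq> d" "b \<noteq> e" "c \<noteq> e"
    using assms no_loops' arc_sym by metis+
  have in_verts: "a \<in> pverts G" "b \<in> pverts G" "c \<in> pverts G" "d \<in> pverts G" "e \<in> pverts G"
    using assms(1-5) in_arcsD1 in_arcsD2 by blast+
  have loops: "(u, u) \<notin> parcs G" for u
    using no_loops' by blast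
  show ?thesis
  proof (rule contains_inducedI[where f = ?f])
    show "pair_wf_digraph G" ..
    show "pair_wf_digraph hammer"
      using pair_graph_hammer by (simp add: pair_graph_def pair_digraph_def pair_fin_digraph_def)
    show "inj_on ?f (pverts hammer)"
      using ne by (auto simp: hammer_def graph_of_edges_def numeral_eq_Suc)
    show "?f ` pverts hammer \<subseteq> pverts G"
      using in_verts by (auto simp: hammer_def graph_of_edges_def numeral_eq_Suc)
    have "\<forall>u\<in>pverts hammer. \<forall>v\<in>pverts hammer. (?f u, ?f v) \<in> parcs G \<longleftrightarrow> (u, v) \<in> parcs hammer"
      by (simp add: hammer_def graph_of_edges_def converse_insert numeral_eq_Suc loops
          assms assms(1-5)[THEN arc_sym_imp] assms(6-10)[THEN not_arc_sym])
    then show "(?f u, ?f v) \<in> parcs G \<longleftrightarrow> (u, v) \<in> parcs hammer"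
      if "u \<in> pverts hammer" "v \<in> pverts hammer" for u v
      using that by blast
  qed
qed

section \<open>Cliques and missed vertices\<close>

lemma finite_clique: "clique G S \<Longrightarrow> finite S"
  using pair_finite_verts finite_subset unfolding clique_def by blast

lemma card_clique_le: "clique G S \<Longrightarrow> card S \<le> clique_number G"
  unfolding clique_number_def using clique_cards(1) by (intro Max_ge) auto

lemma obtain_maximum_clique:
  obtains K where "clique G K" "card K = clique_number G"
  using Max_in[OF clique_cards] unfolding clique_number_def by force

lemma missed_eq:
  assumes "\<not> contains_induced G hammer" "clique G K"
    and "(x, y) \<in> parcs G" "i \<noteq> j" "{i, j} \<subseteq> missed G K x \<inter> missed G K y"
  shows "missed G K x = missed G K y"
proof -
  have "missed G K y \<subseteq> missed G K x"
    if xy: "(x, y) \<in> parcs G" and ij: "{i, j} \<subseteq> missed G K x \<inter> missed G K y" for x y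
  proof (rule ccontr)
    assume "\<not> missed G K y \<subseteq> missed G K x"
    then obtain k where k: "k \<in> missed G K y" "k \<notin> missed G K x" by blast
    then have "i \<noteq> k" "j \<noteq> k" using ij by auto
    then have "contains_induced G hammer"
      using contains_hammerI[of i j k x y] assms(2,4) xy ij k arc_sym
      unfolding missed_def clique_def by blast
    with assms(1) show False by blast
  qed
  from this[of x y] this[of y x] show ?thesis
    using assms(3,5) arc_sym by blast
qed

lemma card_le_card_missed:
  assumes K: "clique G K" "card K = clique_number G"
    and Q: "clique G Q" "\<And>x. x \<in> Q \<Longrightarrow> missed G K x = M"
  shows "card Q \<le> card M"
proof (cases "Q = {}")
  case False
  then have M: "M \<subseteq> K"
    using Q(2) unfolding missed_def by blast
  have fin: "finite K" "finite Q" "finite M"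
    using finite_clique K(1) Q(1) M finite_subset by blast+
  have arc: "(x, v) \<in> parcs G" "(v, x) \<in> parcs G" if "x \<in> Q" "v \<in> K - M" for x v
    using that Q(2) arc_sym unfolding missed_def by blast+
  have "clique G (Q \<union> (K - M))"
    using K(1) Q(1) arc by (auto simp: clique_def)
  then have "card (Q \<union> (K - M)) \<le> card K"
    using card_clique_le K(2) by simp
  \<comment> \<open>By \<open>arc\<close>, a common vertex would be adjacent to itself.\<close>
  moreover have "Q \<inter> (K - M) = {}"
    using arc no_loops' by blast
  then have "card (Q \<union> (K - M)) = card Q + (card K - card M)"
    using fin M by (simp add: card_Un_disjoint card_Diff_subset)
  moreover have "card M \<le> card K"
    using fin M by (simp add: card_mono)
  ultimately show ?thesis by linarith
qed simp

lemma adjacent_same_missed_trans: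
  assumes "\<not> contains_induced G P3_P2" and K: "clique G K" "card K = clique_number G"
    and "(x, y) \<in> parcs G" "(y, z) \<in> parcs G" "x \<noteq> z"
    and M: "missed G K x = missed G K y" "missed G K y = missed G K z"
  shows "(x, z) \<in> parcs G"
proof (rule ccontr)
  assume non: "(x, z) \<notin> parcs G"
  have "x \<noteq> y"
    using assms(4) no_loops' by blast
  have "clique G {x, y}"
    using assms(4) arc_sym_imp[OF assms(4)] in_arcsD1[OF assms(4)] in_arcsD2[OF assms(4)]
    by (auto simp: clique_def)
  then have "card {x, y} \<le> card (missed G K y)"
    by (rule card_le_card_missed[OF K]) (use M(1) in blast)
  then have "2 \<le> card (missed G K y)"
    using \<open>x \<noteq> y\<close> by simp
  then obtain i j where ij: "i \<in> missed G K y" "j \<in> missed G K y" "i \<noteq> j"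
    by (auto simp: card_le_Suc_iff numeral_2_eq_2)
  then have "(i, j) \<in> parcs G"
    using K(1) by (auto simp: clique_def missed_def)
  moreover have "(u, v) \<notin> parcs G" if "u \<in> {x, y, z}" "v \<in> {i, j}" for u v
    using that ij M unfolding missed_def by blast
  ultimately have "contains_induced G P3_P2"
    using contains_P3_P2I[of x y z i j] assms(4-6) non by blast
  with assms(1) show False ..
qed

section \<open>Colouring by pairs of clique vertices\<close>

lemma proper_pair_colouring:
  assumes P: "\<not> contains_induced G P3_P2" and H: "\<not> contains_induced G hammer"
    and K: "clique G K" "card K = clique_number G"
  obtains p where "p ` pverts G \<subseteq> K \<times> K" "\<And>x y. (x, y) \<in> parcs G \<Longrightarrow> p x \<noteq> p y"
proof -
  let ?M = "missed G K"
  \<comment> \<open>By \<open>adjacent_same_missed_trans\<close>, \<open>x\<close> and its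
    neighbours with the same missed set already form a whole component of their class.\<close>
  define Q where "Q x = {y \<in> pverts G. ?M y = ?M x \<and> (y = x \<or> (x, y) \<in> parcs G)}" for x
  have Q_clique: "clique G (Q x)" for x
    unfolding clique_def
  proof (intro conjI ballI impI)
    fix u v assume "u \<in> Q x" "v \<in> Q x" "u \<noteq> v"
    then have "?M u = ?M x" "?M x = ?M v" "u = x \<or> (u, x) \<in> parcs G" "v = x \<or> (x, v) \<in> parcs G"
      by (auto simp: Q_def intro: arc_sym_imp)
    then show "(u, v) \<in> parcs G"
      using adjacent_same_missed_trans[OF P K, of u x v] \<open>u \<noteq> v\<close> by blast
  qed (auto simp: Q_def)
  have Q_eq: "Q x = Q y" if "(x, y) \<in> parcs G" "?M x = ?M y" for x y
  proof -
    have "Q y \<subseteq> Q x" if "(x, y) \<in> parcs G" "?M x = ?M y" for x y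
      using adjacent_same_missed_trans[OF P K, of x y] that unfolding Q_def by auto
    from this[of x y] this[of y x] show ?thesis
      using that arc_sym_imp[OF that(1)] by auto
  qed
  have fin: "finite (Q x)" "finite (?M x)" "card (Q x) \<le> card (?M x)" for x
    using finite_clique[OF Q_clique[of x]] finite_clique[OF K(1)]
      card_le_card_missed[OF K Q_clique[of x], of "?M x"]
    by (auto simp: missed_def Q_def)
  \<comment> \<open>The injection depends on the sets \<open>Q x\<close> and \<open>M x\<close> only, not on the vertex \<open>x\<close>.\<close>
  obtain h :: "'a set \<Rightarrow> 'a set \<Rightarrow> 'a \<Rightarrow> 'a" where
    "\<And>A B. finite A \<Longrightarrow> finite B \<Longrightarrow> card A \<le> card B \<Longrightarrow> h A B ` A \<subseteq> B \<and> inj_on (h A B) A"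
  proof
    let ?h = "\<lambda>A B. SOME h :: 'a \<Rightarrow> 'a. h ` A \<subseteq> B \<and> inj_on h A"
    show "?h A B ` A \<subseteq> B \<and> inj_on (?h A B) A" if "finite A" "finite B" "card A \<le> card B" for A B
      using someI_ex[OF card_le_inj[OF that]] .
  qed
  with fin have h: "h (Q x) (?M x) ` Q x \<subseteq> ?M x" "inj_on (h (Q x) (?M x)) (Q x)" for x
    by blast+
  \<comment> \<open>\<open>s A i\<close> avoids \<open>i\<close> whenever \<open>A\<close> has
    another element.\<close>
  define s where "s A i = (SOME j. j \<in> A \<and> (j = i \<longrightarrow> A = {i}))" for A and i :: 'a
  have s: "s A i \<in> A \<and> (s A i = i \<longrightarrow> A = {i})" if "i \<in> A" for A i
    unfolding s_def by (rule someI_ex) (use that in blast)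
  define i where "i x = h (Q x) (?M x) x" for x
  \<comment> \<open>The first coordinate separates the vertices of one \<open>Q x\<close>; the
    second serves adjacent vertices with different missed sets.\<close>
  define p where "p x = (i x, s (?M x) (i x))" for x
  have i: "i x \<in> ?M x" if "x \<in> pverts G" for x
    using h(1)[of x] that unfolding i_def Q_def by blast
  show ?thesis
  proof
    show "p ` pverts G \<subseteq> K \<times> K"
      using i s unfolding p_def missed_def by blast
    fix x y assume xy: "(x, y) \<in> parcs G"
    then have verts: "x \<in> pverts G" "y \<in> pverts G"
      using in_arcsD1 in_arcsD2 by blast+
    show "p x \<noteq> p y"
    proof
      assume "p x = p y"
      then have eq: "i x = i y" "s (?M x) (i x) = s (?M y) (i x)"
        by (auto simp: p_def)
      have M: "?M x = ?M y"
      \<comment> \<open>A colour with equal coordinates forces both missed sets to be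
        \<open>{i x}\<close>. Otherwise the two coordinates are distinct vertices missed by both
        \<open>x\<close> and \<open>y\<close>.\<close>
      proof (cases "s (?M x) (i x) = i x")
        case True
        then show ?thesis
          using eq s i verts by metis
      next
        case False
        then show ?thesis
          using missed_eq[OF H K(1) xy, of "i x" "s (?M x) (i x)"] eq i[OF verts(1)]
            i[OF verts(2)] s[of "i x" "?M x"] s[of "i x" "?M y"] by simp
      qed
      \<comment> \<open>Hence \<open>i x\<close> and \<open>i y\<close> are values of one map,
        injective on \<open>Q x\<close>.\<close>
      then have "Q x = Q y" "x \<in> Q x" "y \<in> Q x"
        using Q_eq[OF xy] verts xy by (auto simp: Q_def)
      then have "x = y"
        using inj_onD[OF h(2)[of x]] eq(1) M unfolding i_def by metis
      with xy no_loops' show False by blast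
    qed
  qed
qed

end

theorem theorem1p4:
  fixes G :: "'a pair_pre_digraph"
  assumes "pair_graph G"
    and "\<not> contains_induced G P3_P2"
    and "\<not> contains_induced G hammer"
  shows "chromatic_number G \<le> (clique_number G)\<^sup>2"
proof -
  interpret pair_graph G by (rule assms)
  obtain K where K: "clique G K" "card K = clique_number G"
    by (rule obtain_maximum_clique)
  obtain p where p: "p ` pverts G \<subseteq> K \<times> K" "\<And>x y. (x, y) \<in> parcs G \<Longrightarrow> p x \<noteq> p y"
    using proper_pair_colouring[OF assms(2,3) K] by metis
  have "finite (K \<times> K)" "card (K \<times> K) = (clique_number G)\<^sup>2"
    using finite_clique[OF K(1)] K(2) by (simp_all add: power2_eq_square)
  then obtain b where b: "bij_betw b (K \<times> K) {0..<(clique_number G)\<^sup>2}"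
    using ex_bij_betw_finite_nat by metis
  have "proper_colouring G ((clique_number G)\<^sup>2) (b \<circ> p)"
    unfolding proper_colouring_def
  proof (intro conjI ballI)
    show "(b \<circ> p) v < (clique_number G)\<^sup>2" if "v \<in> pverts G" for v
      using bij_betwE[OF b] p(1) that by fastforce
    have "b (p u) \<noteq> b (p v)" if "(u, v) \<in> parcs G" for u v
      using inj_on_contraD[OF bij_betw_imp_inj_on[OF b] p(2)[OF that]] p(1)
        in_arcsD1[OF that] in_arcsD2[OF that] by blast
    then show "case e of (u, v) \<Rightarrow> (b \<circ> p) u \<noteq> (b \<circ> p) v" if "e \<in> parcs G" for e
      using that by (cases e) simp
  qed
  then show ?thesis
    by (rule chromatic_number_le)
qed

end
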